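(* Let $a_n$ and $b_{n,j}$ be real-valued functions defined on $[0,\infty)$ for $n,j\in\mathbb{N}$, and let $w_n>0$, $n\in\mathbb{N}$, and $\kappa\in(0,1)$ be such that assumptions (A1)--(A6) (listed in the context) hold for every $T>0$, with $w=(w_n)_{n=1}^\infty$ and $\kappa$ independent of $T$ (the constants $C_1,C_2,\sigma$ in (A5), (A6) may depend on $T$). Further assume that $$a_1(t)=0\quad\text{and}\quad\sum_{n=1}^{j-1}n\,b_{n,j}(t)=j\qquad\text{for all } j=2,3,\ldots\text{ and } t\in[0,\infty).$$ Let $\mathring{u}\in(\ell_w^1)_+$ and let $u$ be the unique classical solution in $\ell_w^1$ of $$u'(t)=G(t)u(t),\quad t\in(0,\infty);\qquad u(0)=\mathring{u}.$$ (a) If $$\widehat{a}_{0,\infty}:=\inf_{t\in(0,\infty)}\ \inf_{n\ge 2}a_n(t)>0,$$ then $$\bigl\|u(t)-M_1(\mathring{u})e_1\bigr\|_w\le (w_1+1)\|\mathring{u}\|_w\exp\bigl[-\widehat{a}_{0,\infty}(1-\kappa)t\bigr],\qquad t\in[0,\infty).$$ (b) If $$\widehat{a}:=\liminf_{t\to\infty}\ \inf_{n\ge 2}a_n(t)>0,$$ then for every $c<\widehat{a}(1-\kappa)$ there exists $M>0$ such that $$\bigl\|u(t)-M_1(\mathring{u})e_1\bigr\|_w\le Me^{-ct},\qquad t\in[0,\infty).$$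
   Context: $\mathbb{N}=\{1,2,\ldots\}$. $\ell_w^1$ is the complex Banach lattice of complex sequences $f=(f_n)_{n=1}^\infty$ with $\|f\|_w=\sum_{n=1}^\infty w_n|f_n|<\infty$; its positive cone is $(\ell_w^1)_+=\{f\in\ell_w^1: f_n\in\mathbb{R},\ f_n\ge0\ \forall n\}$. $M_1(f)=\sum_{n=1}^\infty n f_n$ for $f\in\ell_w^1$, and $e_1=(1,0,0,\ldots)$. Assumptions, for a given $T>0$: (A1) $a_n(t)\ge 0$ for all $t\in[0,T]$, $n\in\mathbb{N}$. (A2) $b_{n,j}(t)\ge 0$ for all $t\in[0,T]$, $n,j\in\mathbb{N}$, with $b_{n,j}(t)=0$ if $j\le n$. (A3) $w_n\ge n$ for all $n\in\mathbb{N}$. (A4) $\kappa\in(0,1)$ and $\sum_{n=1}^{j-1}w_n b_{n,j}(t)\le\kappa w_j$ for all $t\in[0,T]$ and $j=2,3,\ldots$. There are constants $C_1\ge0$, $C_2\ge 0$ and $\sigma\in(0,1]$ such that: (A5) for all $n\in\mathbb{N}$ and $s,t,\tau\in[0,T]$, $\dfrac{|a_n(t)-a_n(s)|}{1+a_n(\tau)}\le C_1|t-s|^\sigma$; (A6) for all $j\in\{2,3,\ldots\}$ and $s,t,\tau\in[0,T]$, $\dfrac{1}{1+a_j(\tau)}\sum_{n=1}^{j-1}w_n\bigl|a_j(t)b_{n,j}(t)-a_j(s)b_{n,j}(s)\bigr|\le C_2 w_j|t-s|^\sigma$. Operators: for $t\in[0,\infty)$, in $\ell_w^1$, $A(t)f=(-a_n(t)f_n)_{n=1}^\infty$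 with domain $D(A(t))=\{f\in\ell_w^1:(a_n(t)f_n)_{n=1}^\infty\in\ell_w^1\}$; $B(t)f=\bigl(\sum_{j=n+1}^\infty a_j(t)b_{n,j}(t)f_j\bigr)_{n=1}^\infty$ with $D(B(t))=D(A(t))$ (well defined by (A4)); $G(t)=A(t)+B(t)$ with $D(G(t))=D(A(t))$. Classical solution on $[0,\infty)$: a function $u\in C([0,\infty),\ell_w^1)\cap C^1((0,\infty),\ell_w^1)$ with $u(t)\in D(G(t))$ for all $t>0$ satisfying the equation for $t>0$ and $u(0)=\mathring{u}$. Under (A1)--(A6) for every $T>0$, such a solution exists and is unique for every $\mathring{u}\in\ell_w^1$. *)

theory Defs
  imports "HOL-Analysis.Analysis"
begin

text \<open>
  Sequences indexed by the positive integers are functions on \<^typ>\<open>nat\<close>.  Index 0 is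
  not part of a sequence: weights and coefficients are never evaluated there, and elements of
  \<open>ell1w w\<close> are required to vanish there, so that equality of functions is equality of sequences.
\<close>

definition ell1w :: "(nat \<Rightarrow> real) \<Rightarrow> (nat \<Rightarrow> complex) set" where
  "ell1w w = {f. f 0 = 0 \<and> (\<lambda>n. w n * cmod (f n)) summable_on {1..}}"

definition normw :: "(nat \<Rightarrow> real) \<Rightarrow> (nat \<Rightarrow> complex) \<Rightarrow> real" where
  "normw w f = (\<Sum>\<^sub>\<infinity>n\<in>{1..}. w n * cmod (f n))"

definition ell1w_pos :: "(nat \<Rightarrow> real) \<Rightarrow> (nat \<Rightarrow> complex) set" where
  "ell1w_pos w = {f \<in> ell1w w. \<forall>n\<ge>1. f n \<in> \<real> \<and> 0 \<le> Re (f n)}"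

definition M1 :: "(nat \<Rightarrow> complex) \<Rightarrow> complex" where
  "M1 f = (\<Sum>\<^sub>\<infinity>n\<in>{1..}. of_nat n * f n)"

definition e1 :: "nat \<Rightarrow> complex" where
  "e1 = (\<lambda>n. if n = 1 then 1 else 0)"


text \<open>
  Since the weight is a term, the spaces \<open>ell1w w\<close> are not types of class \<open>real_normed_vector\<close>;
  continuity and differentiability with respect to \<open>normw w\<close> are spelled out.
\<close>

definition continuous_on_w ::
    "(nat \<Rightarrow> real) \<Rightarrow> real set \<Rightarrow> (real \<Rightarrow> nat \<Rightarrow> complex) \<Rightarrow> bool" where
  "continuous_on_w w S u \<longleftrightarrow>
     (\<forall>t\<in>S. u t \<in> ell1w w) \<and>
     (\<forall>t\<in>S. ((\<lambda>s. normw w (\<lambda>n. u s n - u t n)) \<longlongrightarrow> 0) (at t within S))"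

definition has_derivative_w ::
    "(nat \<Rightarrow> real) \<Rightarrow> (real \<Rightarrow> nat \<Rightarrow> complex) \<Rightarrow> (nat \<Rightarrow> complex) \<Rightarrow> real \<Rightarrow> bool" where
  "has_derivative_w w u v t \<longleftrightarrow>
     v \<in> ell1w w \<and>
     ((\<lambda>h. normw w (\<lambda>n. (u (t + h) n - u t n) / of_real h - v n)) \<longlongrightarrow> 0) (at 0)"


text \<open>
  The coefficients are written \<open>a n t\<close> for $a_n(t)$ and \<open>b n j t\<close> for $b_{n,j}(t)$.
\<close>

definition A1 :: "(nat \<Rightarrow> real \<Rightarrow> real) \<Rightarrow> real \<Rightarrow> bool" where
  "A1 a T \<longleftrightarrow> (\<forall>t\<in>{0..T}. \<forall>n\<ge>1. 0 \<le> a n t)"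

definition A2 :: "(nat \<Rightarrow> nat \<Rightarrow> real \<Rightarrow> real) \<Rightarrow> real \<Rightarrow> bool" where
  "A2 b T \<longleftrightarrow>
     (\<forall>t\<in>{0..T}. \<forall>n\<ge>1. \<forall>j\<ge>1. 0 \<le> b n j t \<and> (j \<le> n \<longrightarrow> b n j t = 0))"

definition A3 :: "(nat \<Rightarrow> real) \<Rightarrow> bool" where
  "A3 w \<longleftrightarrow> (\<forall>n\<ge>1. real n \<le> w n)"

definition A4 ::
    "(nat \<Rightarrow> real) \<Rightarrow> real \<Rightarrow> (nat \<Rightarrow> nat \<Rightarrow> real \<Rightarrow> real) \<Rightarrow> real \<Rightarrow> bool" where
  "A4 w \<kappa> b T \<longleftrightarrow>
     \<kappa> \<in> {0<..<1} \<and>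
     (\<forall>t\<in>{0..T}. \<forall>j\<ge>2. (\<Sum>n = 1..<j. w n * b n j t) \<le> \<kappa> * w j)"

definition A5 :: "(nat \<Rightarrow> real \<Rightarrow> real) \<Rightarrow> real \<Rightarrow> real \<Rightarrow> real \<Rightarrow> bool" where
  "A5 a C\<^sub>1 \<sigma> T \<longleftrightarrow>
     (\<forall>n\<ge>1. \<forall>s\<in>{0..T}. \<forall>t\<in>{0..T}. \<forall>\<tau>\<in>{0..T}.
        \<bar>a n t - a n s\<bar> / (1 + a n \<tau>) \<le> C\<^sub>1 * \<bar>t - s\<bar> powr \<sigma>)"

definition A6 ::
    "(nat \<Rightarrow> real) \<Rightarrow> (nat \<Rightarrow> real \<Rightarrow> real) \<Rightarrow> (nat \<Rightarrow> nat \<Rightarrow> real \<Rightarrow> real)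
      \<Rightarrow> real \<Rightarrow> real \<Rightarrow> real \<Rightarrow> bool" where
  "A6 w a b C\<^sub>2 \<sigma> T \<longleftrightarrow>
     (\<forall>j\<ge>2. \<forall>s\<in>{0..T}. \<forall>t\<in>{0..T}. \<forall>\<tau>\<in>{0..T}.
        1 / (1 + a j \<tau>) * (\<Sum>n = 1..<j. w n * \<bar>a j t * b n j t - a j s * b n j s\<bar>)
          \<le> C\<^sub>2 * w j * \<bar>t - s\<bar> powr \<sigma>)"

definition frag_assms ::
    "(nat \<Rightarrow> real) \<Rightarrow> real \<Rightarrow> (nat \<Rightarrow> real \<Rightarrow> real) \<Rightarrow> (nat \<Rightarrow> nat \<Rightarrow> real \<Rightarrow> real)
      \<Rightarrow> real \<Rightarrow> bool" where
  "frag_assms w \<kappa> a b T \<longleftrightarrow>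
     A1 a T \<and> A2 b T \<and> A3 w \<and> A4 w \<kappa> b T \<and>
     (\<exists>C\<^sub>1\<ge>0. \<exists>C\<^sub>2\<ge>0. \<exists>\<sigma>\<in>{0<..1}. A5 a C\<^sub>1 \<sigma> T \<and> A6 w a b C\<^sub>2 \<sigma> T)"


definition opA :: "(nat \<Rightarrow> real \<Rightarrow> real) \<Rightarrow> real \<Rightarrow> (nat \<Rightarrow> complex) \<Rightarrow> (nat \<Rightarrow> complex)" where
  "opA a t f = (\<lambda>n. if n = 0 then 0 else - (of_real (a n t) * f n))"

text \<open>The common domain of $A(t)$, $B(t)$ and $G(t)$:\<close>

definition domG :: "(nat \<Rightarrow> real) \<Rightarrow> (nat \<Rightarrow> real \<Rightarrow> real) \<Rightarrow> real \<Rightarrow> (nat \<Rightarrow> complex) set" where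
  "domG w a t = {f \<in> ell1w w. (\<lambda>n. if n = 0 then 0 else of_real (a n t) * f n) \<in> ell1w w}"

text \<open>On \<open>domG w a t\<close> the series below converges absolutely, by A3 and A4.\<close>

definition opB ::
    "(nat \<Rightarrow> real \<Rightarrow> real) \<Rightarrow> (nat \<Rightarrow> nat \<Rightarrow> real \<Rightarrow> real) \<Rightarrow> real
      \<Rightarrow> (nat \<Rightarrow> complex) \<Rightarrow> (nat \<Rightarrow> complex)" where
  "opB a b t f =
     (\<lambda>n. if n = 0 then 0 else (\<Sum>\<^sub>\<infinity>j\<in>{n+1..}. of_real (a j t * b n j t) * f j))"

definition opG ::
    "(nat \<Rightarrow> real \<Rightarrow> real) \<Rightarrow> (nat \<Rightarrow> nat \<Rightarrow> real \<Rightarrow> real) \<Rightarrow> real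
      \<Rightarrow> (nat \<Rightarrow> complex) \<Rightarrow> (nat \<Rightarrow> complex)" where
  "opG a b t f = (\<lambda>n. opA a t f n + opB a b t f n)"

text \<open>
  Classical solutions on $[0,\infty)$: \<open>u'\<close> is the derivative, whose continuity on $(0,\infty)$
  expresses that \<open>u\<close> is $C^1$ there.
\<close>

definition classical_solution ::
    "(nat \<Rightarrow> real) \<Rightarrow> (nat \<Rightarrow> real \<Rightarrow> real) \<Rightarrow> (nat \<Rightarrow> nat \<Rightarrow> real \<Rightarrow> real)
      \<Rightarrow> (nat \<Rightarrow> complex) \<Rightarrow> (real \<Rightarrow> nat \<Rightarrow> complex) \<Rightarrow> bool" where
  "classical_solution w a b u\<^sub>0 u \<longleftrightarrow>
     continuous_on_w w {0..} u \<and>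
     (\<exists>u'. continuous_on_w w {0<..} u' \<and>
        (\<forall>t>0. has_derivative_w w u (u' t) t \<and> u t \<in> domG w a t \<and> u' t = opG a b t (u t))) \<and>
     u 0 = u\<^sub>0"

end

theory Submission
  imports Defs
begin

text \<open>
  The tail \<open>\<Phi>(t) = (\<Sum>n\<ge>2. w\<^sub>n \<bar>u\<^sub>n(t)\<bar>)\<close> loses \<open>w\<^sub>n a\<^sub>n \<bar>u\<^sub>n\<bar>\<close> through \<open>A(t)\<close> and regains
  at most the fraction \<open>\<kappa>\<close> of it through \<open>B(t)\<close>, so it decays at rate \<open>(1 - \<kappa>) inf a\<^sub>n\<close>.  The
  mass \<open>M1 (u t)\<close> is conserved, hence \<open>u\<^sub>1(t) - M1 u\<^sub>0 = - (\<Sum>n\<ge>2. n u\<^sub>n(t))\<close> is bounded by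
  \<open>\<Phi>(t)\<close>, as \<open>n \<le> w\<^sub>n\<close>.

  Since \<open>\<Phi>\<close> need not be differentiable and \<open>a\<^sub>n\<close> may be unbounded in \<open>n\<close>, the differential
  inequality is replaced by a bound on the backward difference quotient: for \<open>h > 0\<close>, up to \<open>o(h)\<close>,
  \<open>u(t - h)\<close> is \<open>(1 + h a\<^sub>n) u\<^sub>n - h (B(t) u)\<^sub>n\<close>, and the factors \<open>1 + h a\<^sub>n\<close> are nonnegative
  however large \<open>a\<^sub>n\<close> is.
\<close>

subsection \<open>Weighted norms and the mass functional\<close>

text \<open>As \<open>ell1w w\<close> is a set and not a type, closure under vector operations is
  proved by hand. One two-term combination covers differences, difference quotients and
  negation.\<close>

lemma ell1w_lincomb:
  assumes "\<forall>n\<ge>1. 0 \<le> w n" "f \<in> ell1w w" "g \<in> ell1w w"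
  shows "(\<lambda>n. c * f n + d * g n) \<in> ell1w w"
proof -
  have "(\<lambda>n. cmod c * (w n * cmod (f n)) + cmod d * (w n * cmod (g n))) summable_on {1..}"
    using assms by (intro summable_on_add summable_on_cmult_right) (auto simp: ell1w_def)
  then have "(\<lambda>n. w n * cmod (c * f n + d * g n)) summable_on {1..}"
  proof (rule summable_on_comparison_test)
    fix n :: nat assume n: "n \<in> {1..}"
    have "w n * cmod (c * f n + d * g n) \<le> w n * (cmod c * cmod (f n) + cmod d * cmod (g n))"
      using assms n by (intro mult_left_mono order_trans[OF norm_triangle_ineq]) (auto simp: norm_mult)
    then show "w n * cmod (c * f n + d * g n) \<le> cmod c * (w n * cmod (f n)) + cmod d * (w n * cmod (g n))"
      by (simp add: algebra_simps)
  qed (use assms in auto)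
  then show ?thesis
    using assms by (auto simp: ell1w_def)
qed

lemma ell1w_diff:
  assumes "\<forall>n\<ge>1. 0 \<le> w n" "f \<in> ell1w w" "g \<in> ell1w w"
  shows "(\<lambda>n. f n - g n) \<in> ell1w w"
  using ell1w_lincomb[OF assms, of 1 "-1"] by simp

lemma ell1w_summable_tail:
  assumes "f \<in> ell1w w"
  shows "(\<lambda>n. w n * cmod (f n)) summable_on {2..}"
  using assms by (auto simp: ell1w_def intro: summable_on_subset_banach)

text \<open>A seminorm that ignores index 1, the component that does not decay because
  \<open>a 1 t = 0\<close>. The decay estimates are proved for it and transferred to
  \<open>normw\<close> at the end.\<close>

definition tailw :: "(nat \<Rightarrow> real) \<Rightarrow> (nat \<Rightarrow> complex) \<Rightarrow> real" where
  "tailw w f = (\<Sum>\<^sub>\<infinity>n\<in>{2..}. w n * cmod (f n))"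

lemma infsum_split_first:
  fixes g :: "nat \<Rightarrow> 'a::banach"
  assumes "g summable_on {1..}"
  shows "(\<Sum>\<^sub>\<infinity>n\<in>{1..}. g n) = g 1 + (\<Sum>\<^sub>\<infinity>n\<in>{2..}. g n)"
proof -
  have eq: "{1..} = {1::nat} \<union> {2..}" by auto
  have "g summable_on {2..}"
    by (rule summable_on_subset_banach[OF assms]) auto
  then have "infsum g ({1} \<union> {2..}) = infsum g {1} + infsum g {2..}"
    by (intro infsum_Un_disjoint) auto
  then show ?thesis unfolding eq by simp
qed

lemma normw_split:
  assumes "f \<in> ell1w w"
  shows "normw w f = w 1 * cmod (f 1) + tailw w f"
  using assms unfolding normw_def tailw_def ell1w_def by (intro infsum_split_first) auto

lemma tailw_nonneg: "\<forall>n\<ge>1. 0 \<le> w n \<Longrightarrow> 0 \<le> tailw w f"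
  unfolding tailw_def by (intro infsum_nonneg) auto

lemma tailw_le_normw:
  assumes "\<forall>n\<ge>1. 0 \<le> w n" "f \<in> ell1w w"
  shows "tailw w f \<le> normw w f"
  using normw_split[OF assms(2)] assms(1) by simp

lemma tailw_triangle:
  assumes w: "\<forall>n\<ge>1. 0 \<le> w n" and fg: "f \<in> ell1w w" "g \<in> ell1w w"
  shows "\<bar>tailw w f - tailw w g\<bar> \<le> tailw w (\<lambda>n. f n - g n)"
proof -
  have s: "(\<lambda>n. w n * cmod (f n - g n)) summable_on {2..}"
    by (intro ell1w_summable_tail ell1w_diff w fg)
  have "tailw w f \<le> tailw w g + tailw w (\<lambda>n. f n - g n)"
    unfolding tailw_def infsum_add[OF ell1w_summable_tail[OF fg(2)] s, symmetric]
  proof (intro infsum_mono summable_on_add ell1w_summable_tail[OF fg(1)] ell1w_summable_tail[OF fg(2)] s)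
    fix n :: nat assume "n \<in> {2..}"
    then have "w n * cmod (f n) \<le> w n * (cmod (g n) + cmod (f n - g n))"
      using w by (intro mult_left_mono norm_triangle_sub) auto
    then show "w n * cmod (f n) \<le> w n * cmod (g n) + w n * cmod (f n - g n)"
      by (simp add: algebra_simps)
  qed
  moreover have "tailw w g \<le> tailw w f + tailw w (\<lambda>n. f n - g n)"
    unfolding tailw_def infsum_add[OF ell1w_summable_tail[OF fg(1)] s, symmetric]
  proof (intro infsum_mono summable_on_add ell1w_summable_tail[OF fg(1)] ell1w_summable_tail[OF fg(2)] s)
    fix n :: nat assume "n \<in> {2..}"
    then have "w n * cmod (g n) \<le> w n * (cmod (f n) + cmod (f n - g n))"
      using w norm_triangle_sub[of "g n" "f n"] by (intro mult_left_mono) (auto simp: norm_minus_commute)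
    then show "w n * cmod (g n) \<le> w n * cmod (f n) + w n * cmod (f n - g n)"
      by (simp add: algebra_simps)
  qed
  ultimately show ?thesis by simp
qed

lemma mass_abs_summable:
  assumes "A3 w" "f \<in> ell1w w"
  shows "(\<lambda>n. cmod (of_nat n * f n)) summable_on {1..}"
proof (rule summable_on_comparison_test)
  show "(\<lambda>n. w n * cmod (f n)) summable_on {1..}"
    using assms by (simp add: ell1w_def)
qed (use assms(1) in \<open>auto simp: norm_mult A3_def mult_right_mono\<close>)

lemma norm_M1_le:
  assumes "A3 w" "f \<in> ell1w w"
  shows "cmod (M1 f) \<le> normw w f"
proof -
  have "cmod (M1 f) \<le> (\<Sum>\<^sub>\<infinity>n\<in>{1..}. cmod (of_nat n * f n))"
    unfolding M1_def by (rule norm_infsum_bound[OF mass_abs_summable[OF assms]])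
  also have "\<dots> \<le> normw w f"
    unfolding normw_def using assms mass_abs_summable[OF assms]
    by (intro infsum_mono) (auto simp: norm_mult ell1w_def A3_def mult_right_mono)
  finally show ?thesis .
qed

lemma M1_lincomb:
  assumes "A3 w" "f \<in> ell1w w" "g \<in> ell1w w"
  shows "M1 (\<lambda>n. c * f n + d * g n) = c * M1 f + d * M1 g"
proof -
  note s = mass_abs_summable[OF assms(1), THEN abs_summable_summable]
  have "M1 (\<lambda>n. c * f n + d * g n)
      = (\<Sum>\<^sub>\<infinity>n\<in>{1..}. c * (of_nat n * f n) + d * (of_nat n * g n))"
    unfolding M1_def by (intro infsum_cong) (simp add: algebra_simps)
  also have "\<dots> = c * M1 f + d * M1 g"
    unfolding M1_def using s[OF assms(2)] s[OF assms(3)]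
    by (simp add: infsum_add summable_on_cmult_right infsum_cmult_right)
  finally show ?thesis .
qed

lemma norm_first_minus_M1_le:
  assumes A3: "A3 w" and f: "f \<in> ell1w w"
  shows "cmod (f 1 - M1 f) \<le> tailw w f"
proof -
  have s: "(\<lambda>n. cmod (of_nat n * f n)) summable_on {2..}"
    by (rule summable_on_subset_banach[OF mass_abs_summable[OF assms]]) auto
  have "M1 f = f 1 + (\<Sum>\<^sub>\<infinity>n\<in>{2..}. of_nat n * f n)"
    unfolding M1_def using infsum_split_first[OF abs_summable_summable[OF mass_abs_summable[OF assms]]]
    by simp
  then have "cmod (f 1 - M1 f) = cmod (\<Sum>\<^sub>\<infinity>n\<in>{2..}. of_nat n * f n)"
    by (simp add: norm_minus_commute)
  also have "\<dots> \<le> (\<Sum>\<^sub>\<infinity>n\<in>{2..}. cmod (of_nat n * f n))"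
    by (rule norm_infsum_bound[OF s])
  also have "\<dots> \<le> tailw w f"
    unfolding tailw_def using A3 s ell1w_summable_tail[OF f]
    by (intro infsum_mono) (auto simp: norm_mult A3_def mult_right_mono)
  finally show ?thesis .
qed

text \<open>Subtracting a multiple of \<open>e1\<close> changes only the first coordinate. That
  coordinate contributes \<open>w 1\<close> times the tail, and the unchanged tail itself
  contributes the summand 1.\<close>

lemma normw_minus_equilibrium_le:
  assumes w: "\<forall>n\<ge>1. 0 \<le> w n" and A3: "A3 w" and f: "f \<in> ell1w w"
  shows "normw w (\<lambda>n. f n - M1 f * e1 n) \<le> (w 1 + 1) * tailw w f"
proof -
  have "(\<lambda>n. w n * cmod (e1 n)) summable_on {1..}"
    by (intro has_sum_imp_summable[OF has_sum_finite_neutralI[where B="{1}"]]) (auto simp: e1_def)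
  then have "e1 \<in> ell1w w"
    by (simp add: ell1w_def e1_def)
  then have "(\<lambda>n. f n - M1 f * e1 n) \<in> ell1w w"
    using ell1w_lincomb[OF w f, of e1 1 "- M1 f"] by simp
  then have "normw w (\<lambda>n. f n - M1 f * e1 n)
      = w 1 * cmod (f 1 - M1 f * e1 1) + tailw w (\<lambda>n. f n - M1 f * e1 n)"
    by (rule normw_split)
  also have "tailw w (\<lambda>n. f n - M1 f * e1 n) = tailw w f"
    unfolding tailw_def by (intro infsum_cong) (auto simp: e1_def)
  also have "w 1 * cmod (f 1 - M1 f * e1 1) \<le> w 1 * tailw w f"
    using norm_first_minus_M1_le[OF A3 f] w by (intro mult_left_mono) (auto simp: e1_def)
  finally show ?thesis by (simp add: algebra_simps)
qed

subsection \<open>The fragmentation operator at a fixed time\<close>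

text \<open>Fubini for the fragmentation term. For fixed \<open>j\<close> only the finitely many
  \<open>n < j\<close> contribute, and \<open>bound\<close> controls their sum, so the double series
  converges absolutely. The weight \<open>v\<close> is separate from \<open>w\<close> to serve two
  purposes: \<open>v n = n\<close> for the balance of mass, and \<open>w\<close> with its first
  entry removed for the tail.\<close>

lemma fragmentation_swap:
  fixes f :: "nat \<Rightarrow> 'a::banach"
  assumes nonneg: "\<forall>n\<ge>1. 0 \<le> \<alpha> n" "\<forall>n\<ge>1. \<forall>j\<ge>1. 0 \<le> \<beta> n j" "\<forall>n\<ge>1. 0 \<le> v n"
    and upper: "\<forall>n\<ge>1. \<forall>j\<ge>1. j \<le> n \<longrightarrow> \<beta> n j = 0"
    and w: "\<forall>n\<ge>1. 0 \<le> w n" and c: "0 \<le> c"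
    and bound: "\<forall>j\<ge>2. (\<Sum>n = 1..<j. v n * \<beta> n j) \<le> c * w j"
    and f: "(\<lambda>j. w j * (\<alpha> j * norm (f j))) summable_on {1..}"
  shows "(\<lambda>(n, j). (v n * (\<alpha> j * \<beta> n j)) *\<^sub>R f j) summable_on {1..} \<times> {1..}"
    and "(\<Sum>\<^sub>\<infinity>n\<in>{1..}. \<Sum>\<^sub>\<infinity>j\<in>{1..}. (v n * (\<alpha> j * \<beta> n j)) *\<^sub>R f j)
       = (\<Sum>\<^sub>\<infinity>j\<in>{1..}. (\<alpha> j * (\<Sum>n = 1..<j. v n * \<beta> n j)) *\<^sub>R f j)"
    and "(\<lambda>j. \<alpha> j * (\<Sum>n = 1..<j. v n * \<beta> n j) * norm (f j)) summable_on {1..}"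
proof -
  define g where "g j = \<alpha> j * (\<Sum>n = 1..<j. v n * \<beta> n j) * norm (f j)" for j
  show g: "(\<lambda>j. \<alpha> j * (\<Sum>n = 1..<j. v n * \<beta> n j) * norm (f j)) summable_on {1..}"
  proof (rule summable_on_comparison_test)
    show "(\<lambda>j. c * (w j * (\<alpha> j * norm (f j)))) summable_on {1..}"
      by (intro summable_on_cmult_right f)
    fix j :: nat assume j: "j \<in> {1..}"
    have "(\<Sum>n = 1..<j. v n * \<beta> n j) \<le> c * w j"
    \<comment> \<open>\<open>bound\<close> starts at 2; for \<open>j = 1\<close> the sum is
      empty.\<close>
    proof (cases "j = 1")
      case False
      then show ?thesis using bound j by auto
    qed (use c w in auto)
    then have "(\<alpha> j * norm (f j)) * (\<Sum>n = 1..<j. v n * \<beta> n j) \<le> (\<alpha> j * norm (f j)) * (c * w j)"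
      using nonneg j by (intro mult_left_mono) auto
    then show "\<alpha> j * (\<Sum>n = 1..<j. v n * \<beta> n j) * norm (f j) \<le> c * (w j * (\<alpha> j * norm (f j)))"
      by (simp add: algebra_simps)
    show "0 \<le> \<alpha> j * (\<Sum>n = 1..<j. v n * \<beta> n j) * norm (f j)"
      using nonneg j by (intro mult_nonneg_nonneg sum_nonneg) auto
  qed
  have "(\<lambda>(j, n). v n * (\<alpha> j * \<beta> n j) * norm (f j)) summable_on {1..} \<times> {1..}"
  proof (rule summable_on_SigmaI)
    show "g summable_on {1..}" using g by (simp add: g_def[abs_def])
    fix j :: nat assume j: "j \<in> {1..}"
    show "((\<lambda>n. case (j, n) of (j, n) \<Rightarrow> v n * (\<alpha> j * \<beta> n j) * norm (f j)) has_sum g j) {1..}"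
      by (rule has_sum_finite_neutralI[where B="{1..<j}"])
         (use upper j in \<open>auto simp: g_def sum_distrib_left sum_distrib_right mult_ac\<close>)
  qed (use nonneg in auto)
  then have "(\<lambda>(n, j). v n * (\<alpha> j * \<beta> n j) * norm (f j)) summable_on {1..} \<times> {1..}"
    by (subst summable_on_swap) simp
  then have "(\<lambda>p. norm ((\<lambda>(n, j). (v n * (\<alpha> j * \<beta> n j)) *\<^sub>R f j) p)) summable_on {1..} \<times> {1..}"
    by (rule summable_on_cong[THEN iffD1, rotated]) (use nonneg in auto)
  then show s: "(\<lambda>(n, j). (v n * (\<alpha> j * \<beta> n j)) *\<^sub>R f j) summable_on {1..} \<times> {1..}"
    by (rule abs_summable_summable)
  have "(\<Sum>\<^sub>\<infinity>n\<in>{1..}. (v n * (\<alpha> j * \<beta> n j)) *\<^sub>R f j) = (\<alpha> j * (\<Sum>n = 1..<j. v n * \<beta> n j)) *\<^sub>R f j"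
    if "j \<in> {1..}" for j
    by (rule infsumI, rule has_sum_finite_neutralI[where B="{1..<j}"])
       (use upper that in \<open>auto simp: sum_distrib_left scaleR_sum_left mult_ac\<close>)
  then show "(\<Sum>\<^sub>\<infinity>n\<in>{1..}. \<Sum>\<^sub>\<infinity>j\<in>{1..}. (v n * (\<alpha> j * \<beta> n j)) *\<^sub>R f j)
       = (\<Sum>\<^sub>\<infinity>j\<in>{1..}. (\<alpha> j * (\<Sum>n = 1..<j. v n * \<beta> n j)) *\<^sub>R f j)"
    by (subst infsum_swap_banach[OF s]) (intro infsum_cong, auto)
qed

lemma domG_summable:
  assumes "\<forall>n\<ge>1. 0 \<le> a n t" "f \<in> domG w a t"
  shows "(\<lambda>n. w n * (a n t * cmod (f n))) summable_on {1..}"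
proof -
  have "(\<lambda>n. w n * cmod (if n = 0 then 0 else of_real (a n t) * f n)) summable_on {1..}"
    using assms by (simp add: domG_def ell1w_def)
  then show ?thesis
    by (rule summable_on_cong[THEN iffD1, rotated]) (use assms in \<open>auto simp: norm_mult\<close>)
qed

text \<open>Since \<open>b n j t\<close> vanishes for \<open>j \<le> n\<close>, the series may start
  at 1. Its range then no longer depends on \<open>n\<close>, as the interchange of sums
  requires.\<close>

lemma opB_eq:
  assumes "\<forall>n\<ge>1. \<forall>j\<ge>1. j \<le> n \<longrightarrow> b n j t = 0" "n \<ge> 1"
  shows "opB a b t f n = (\<Sum>\<^sub>\<infinity>j\<in>{1..}. (a j t * b n j t) *\<^sub>R f j)"
proof -
  have "(\<Sum>\<^sub>\<infinity>j\<in>{n+1..}. of_real (a j t * b n j t) * f j) = (\<Sum>\<^sub>\<infinity>j\<in>{1..}. (a j t * b n j t) *\<^sub>R f j)"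
    by (rule infsum_cong_neutral) (use assms in \<open>auto simp: scaleR_conv_of_real not_less_eq_eq\<close>)
  then show ?thesis using assms(2) by (simp add: opB_def)
qed

text \<open>After the interchange of sums, the fragments of size-\<open>j\<close> clusters carry
  mass \<open>j * a j t * f j\<close>, which is exactly what \<open>opA\<close> removes. For
  \<open>j = 1\<close> both sides vanish because \<open>a 1 t = 0\<close>.\<close>

lemma M1_opG:
  assumes nonneg: "\<forall>n\<ge>1. 0 \<le> a n t" "\<forall>n\<ge>1. \<forall>j\<ge>1. 0 \<le> b n j t"
    and upper: "\<forall>n\<ge>1. \<forall>j\<ge>1. j \<le> n \<longrightarrow> b n j t = 0"
    and A3: "A3 w"
    and mass: "\<forall>j\<ge>2. (\<Sum>n = 1..<j. real n * b n j t) = real j" and a1: "a 1 t = 0"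
    and f: "f \<in> domG w a t"
  shows "M1 (opG a b t f) = 0"
proof -
  have w: "\<forall>n\<ge>1. 0 \<le> w n"
    using A3 unfolding A3_def by (meson of_nat_0_le_iff order_trans)
  \<comment> \<open>The mass identity and \<open>j \<le> w j\<close> give the bound with constant
    1.\<close>
  have bnd: "\<forall>j\<ge>2. (\<Sum>n = 1..<j. real n * b n j t) \<le> 1 * w j"
    using mass A3 by (auto simp: A3_def)
  note sw = fragmentation_swap[where v=real and \<alpha>="\<lambda>j. a j t" and \<beta>="\<lambda>n j. b n j t" and f=f,
      OF nonneg _ upper w _ bnd domG_summable[OF nonneg(1) f]]
  have B: "of_nat n * opB a b t f n = (\<Sum>\<^sub>\<infinity>j\<in>{1..}. (real n * (a j t * b n j t)) *\<^sub>R f j)"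
    if "n \<in> {1..}" for n
  proof -
    have "of_nat n * opB a b t f n = real n *\<^sub>R (\<Sum>\<^sub>\<infinity>j\<in>{1..}. (a j t * b n j t) *\<^sub>R f j)"
      using that opB_eq[of b t n a f, OF upper] by (simp add: scaleR_conv_of_real)
    then show ?thesis by (simp flip: infsum_scaleR_right)
  qed
  \<comment> \<open>The absolutely convergent double series yields this directly, without showing
    that \<open>opB a b t f\<close> lies in \<open>ell1w w\<close>.\<close>
  have sB: "(\<lambda>n. of_nat n * opB a b t f n) summable_on {1..}"
    by (rule summable_on_cong[THEN iffD2, OF B summable_on_Sigma_banach[OF sw(1)]]) auto
  have Af: "(\<lambda>n. if n = 0 then 0 else of_real (a n t) * f n) \<in> ell1w w"
    using f by (simp add: domG_def)
  have "opA a t f = (\<lambda>n. - 1 * (if n = 0 then 0 else of_real (a n t) * f n) + 0 * f n)"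
    by (auto simp: opA_def)
  moreover have "f \<in> ell1w w" using f by (simp add: domG_def)
  ultimately have "opA a t f \<in> ell1w w"
    using ell1w_lincomb[OF w Af, of f "- 1" 0] by simp
  then have sA: "(\<lambda>n. of_nat n * opA a t f n) summable_on {1..}"
    by (intro abs_summable_summable[OF mass_abs_summable[OF A3]])
  have "M1 (opG a b t f) = (\<Sum>\<^sub>\<infinity>n\<in>{1..}. of_nat n * opA a t f n) + (\<Sum>\<^sub>\<infinity>n\<in>{1..}. of_nat n * opB a b t f n)"
    unfolding M1_def opG_def using infsum_add[OF sA sB] by (simp add: distrib_left)
  also have "(\<Sum>\<^sub>\<infinity>n\<in>{1..}. of_nat n * opB a b t f n)
     = (\<Sum>\<^sub>\<infinity>n\<in>{1..}. \<Sum>\<^sub>\<infinity>j\<in>{1..}. (real n * (a j t * b n j t)) *\<^sub>R f j)"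
    by (intro infsum_cong B)
  also have "\<dots> = (\<Sum>\<^sub>\<infinity>j\<in>{1..}. (a j t * (\<Sum>n = 1..<j. real n * b n j t)) *\<^sub>R f j)"
    by (rule sw(2)) auto
  also have "\<dots> = (\<Sum>\<^sub>\<infinity>j\<in>{1..}. - (of_nat j * opA a t f j))"
  proof (rule infsum_cong)
    fix j :: nat assume j: "j \<in> {1..}"
    show "(a j t * (\<Sum>n = 1..<j. real n * b n j t)) *\<^sub>R f j = - (of_nat j * opA a t f j)"
    proof (cases "j = 1")
      case True
      then show ?thesis using a1 by (simp add: opA_def)
    next
      case False
      then have "(\<Sum>n = 1..<j. real n * b n j t) = real j" using mass j by auto
      then show ?thesis using j by (simp add: opA_def scaleR_conv_of_real)
    qed
  qed
  finally show ?thesis by (simp add: infsum_uminus)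
qed

text \<open>The triangle inequality and the interchange of sums reduce this to the bound on the
  column sums of \<open>b\<close>. The right-hand side also starts at 2, because the column
  \<open>j = 1\<close> is empty: clusters of size 1 do not fragment.\<close>

lemma tailw_opB_le:
  assumes nonneg: "\<forall>n\<ge>1. 0 \<le> a n t" "\<forall>n\<ge>1. \<forall>j\<ge>1. 0 \<le> b n j t"
    and upper: "\<forall>n\<ge>1. \<forall>j\<ge>1. j \<le> n \<longrightarrow> b n j t = 0"
    and w: "\<forall>n\<ge>1. 0 \<le> w n" and \<kappa>: "0 \<le> \<kappa>"
    and bound: "\<forall>j\<ge>2. (\<Sum>n = 1..<j. w n * b n j t) \<le> \<kappa> * w j"
    and f: "f \<in> domG w a t"
  shows "(\<lambda>n. w n * cmod (opB a b t f n)) summable_on {2..}"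
    and "tailw w (opB a b t f) \<le> \<kappa> * (\<Sum>\<^sub>\<infinity>n\<in>{2..}. w n * (a n t * cmod (f n)))"
proof -
  \<comment> \<open>The zero at 1 turns a sum over \<open>{2..}\<close> into one over
    \<open>{1..}\<close>, the form that \<open>fragmentation_swap\<close> treats.\<close>
  define v where "v n = (if n = 1 then 0 else w n)" for n
  define F where "F n j = (v n * (a j t * b n j t)) *\<^sub>R cmod (f j)" for n j
  have v: "\<forall>n\<ge>1. 0 \<le> v n" using w by (simp add: v_def)
  have bnd: "\<forall>j\<ge>2. (\<Sum>n = 1..<j. v n * b n j t) \<le> \<kappa> * w j"
  proof (intro allI impI)
    fix j :: nat assume j: "j \<ge> 2"
    have "(\<Sum>n = 1..<j. v n * b n j t) \<le> (\<Sum>n = 1..<j. w n * b n j t)"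
      using w nonneg(2) by (intro sum_mono) (auto simp: v_def)
    then show "(\<Sum>n = 1..<j. v n * b n j t) \<le> \<kappa> * w j"
      using bound j by fastforce
  qed
  have sf: "(\<lambda>n. w n * (a n t * cmod (f n))) summable_on {1..}"
    by (rule domG_summable[OF nonneg(1) f])
  then have sf': "(\<lambda>n. w n * (a n t * norm (cmod (f n)))) summable_on {1..}" by simp
  note sw = fragmentation_swap[where \<alpha>="\<lambda>j. a j t" and \<beta>="\<lambda>n j. b n j t" and f="\<lambda>j. cmod (f j)",
      OF nonneg v upper w \<kappa> bnd sf']
  have "(\<lambda>(n,j). F n j) summable_on {1..} \<times> {1..}"
    using sw(1) by (simp add: F_def)
  then have sF: "(\<lambda>n. \<Sum>\<^sub>\<infinity>j\<in>{1..}. F n j) summable_on {1..}"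
    and sF1: "\<And>n. n \<ge> 1 \<Longrightarrow> (\<lambda>j. F n j) summable_on {1..}"
    by (auto intro: summable_on_Sigma_banach summable_on_SigmaD1)
  have F_nonneg: "0 \<le> F n j" if "n \<ge> 1" "j \<ge> 1" for n j
    using that v nonneg by (simp add: F_def)
  have le: "w n * cmod (opB a b t f n) \<le> (\<Sum>\<^sub>\<infinity>j\<in>{1..}. F n j)" if "n \<in> {2..}" for n
  proof -
    have n: "n \<ge> 1" "v n = w n" using that by (auto simp: v_def)
    have "w n * cmod (opB a b t f n) = cmod (\<Sum>\<^sub>\<infinity>j\<in>{1..}. (w n * (a j t * b n j t)) *\<^sub>R f j)"
    proof -
      have "w n * cmod (opB a b t f n) = cmod (w n *\<^sub>R (\<Sum>\<^sub>\<infinity>j\<in>{1..}. (a j t * b n j t) *\<^sub>R f j))"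
        using opB_eq[of b t n a f, OF upper n(1)] w n by simp
      then show ?thesis by (simp flip: infsum_scaleR_right)
    qed
    also have "\<dots> \<le> (\<Sum>\<^sub>\<infinity>j\<in>{1..}. cmod ((w n * (a j t * b n j t)) *\<^sub>R f j))"
      by (rule norm_infsum_bound, rule summable_on_cong[THEN iffD1, OF _ sF1[OF n(1)]])
         (use n nonneg w in \<open>auto simp: F_def\<close>)
    also have "\<dots> = (\<Sum>\<^sub>\<infinity>j\<in>{1..}. F n j)"
      by (intro infsum_cong) (use n nonneg w in \<open>auto simp: F_def\<close>)
    finally show ?thesis .
  qed
  have sF2: "(\<lambda>n. \<Sum>\<^sub>\<infinity>j\<in>{1..}. F n j) summable_on {2..}"
    by (rule summable_on_subset_banach[OF sF]) auto
  show sB: "(\<lambda>n. w n * cmod (opB a b t f n)) summable_on {2..}"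
    by (rule summable_on_comparison_test[OF sF2 le]) (use w in auto)
  have "tailw w (opB a b t f) \<le> (\<Sum>\<^sub>\<infinity>n\<in>{2..}. \<Sum>\<^sub>\<infinity>j\<in>{1..}. F n j)"
    unfolding tailw_def by (intro infsum_mono sB sF2 le)
  also have "\<dots> = (\<Sum>\<^sub>\<infinity>n\<in>{1..}. \<Sum>\<^sub>\<infinity>j\<in>{1..}. F n j)"
    using infsum_split_first[OF sF] by (simp add: F_def v_def)
  also have "\<dots> = (\<Sum>\<^sub>\<infinity>j\<in>{1..}. (a j t * (\<Sum>n = 1..<j. v n * b n j t)) * cmod (f j))"
    unfolding F_def using sw(2) by simp
  \<comment> \<open>The term \<open>j = 1\<close> contains a sum over the empty range
    \<open>{1..<1}\<close>.\<close>
  also have "\<dots> = (\<Sum>\<^sub>\<infinity>j\<in>{2..}. (a j t * (\<Sum>n = 1..<j. v n * b n j t)) * cmod (f j))"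
    using infsum_split_first[OF sw(3)] by simp
  also have "\<dots> \<le> (\<Sum>\<^sub>\<infinity>j\<in>{2..}. \<kappa> * (w j * (a j t * cmod (f j))))"
  proof (rule infsum_mono)
    show "(\<lambda>j. (a j t * (\<Sum>n = 1..<j. v n * b n j t)) * cmod (f j)) summable_on {2..}"
      using sw(3) by (auto intro: summable_on_subset_banach[of _ "{1..}"])
    show "(\<lambda>j. \<kappa> * (w j * (a j t * cmod (f j)))) summable_on {2..}"
      by (intro summable_on_cmult_right, rule summable_on_subset_banach[OF sf]) auto
    fix j :: nat assume j: "j \<in> {2..}"
    have "(a j t * cmod (f j)) * (\<Sum>n = 1..<j. v n * b n j t) \<le> (a j t * cmod (f j)) * (\<kappa> * w j)"
      using bnd nonneg j by (intro mult_left_mono) auto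
    then show "(a j t * (\<Sum>n = 1..<j. v n * b n j t)) * cmod (f j) \<le> \<kappa> * (w j * (a j t * cmod (f j)))"
      by (simp add: algebra_simps)
  qed
  also have "\<dots> = \<kappa> * (\<Sum>\<^sub>\<infinity>n\<in>{2..}. w n * (a n t * cmod (f n)))"
    by (intro infsum_cmult_right) (rule summable_on_subset_banach[OF sf], auto)
  finally show "tailw w (opB a b t f) \<le> \<kappa> * (\<Sum>\<^sub>\<infinity>n\<in>{2..}. w n * (a n t * cmod (f n)))" .
qed

subsection \<open>Backward difference estimates\<close>

text \<open>The hypothesis bounds backward difference quotients by every positive
  \<open>\<epsilon>\<close>. By continuity, the points reachable from \<open>t\<close> going left
  along slope \<open>\<epsilon>\<close> form a compact set; its minimum must be \<open>s\<close>,
  since from any other point the estimate leads further left.\<close>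

lemma nonincreasing_from_left_estimate:
  fixes f :: "real \<Rightarrow> real"
  assumes st: "s \<le> t" and cont: "continuous_on {s..t} f"
    and est: "\<And>x \<epsilon>. x \<in> {s<..t} \<Longrightarrow> \<epsilon> > 0 \<Longrightarrow> \<forall>\<^sub>F h in at_right 0. f x - \<epsilon> * h \<le> f (x - h)"
  shows "f t \<le> f s"
proof -
  have "f t \<le> f s + \<epsilon> * (t - s)" if \<epsilon>: "\<epsilon> > 0" for \<epsilon>
  proof -
    define S where "S = {x\<in>{s..t}. f t - f x - \<epsilon> * (t - x) \<le> 0}"
    have "closed S"
      unfolding S_def by (intro continuous_on_closed_Collect_le continuous_intros cont)
    moreover have "S \<subseteq> {s..t}" by (auto simp: S_def)
    ultimately have "compact S"
      by (meson bounded_closed_interval bounded_subset compact_eq_bounded_closed)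
    moreover have "t \<in> S" using st by (simp add: S_def)
    ultimately obtain x where x: "x \<in> S" and min: "\<And>y. y \<in> S \<Longrightarrow> x \<le> y"
      using compact_attains_inf[of S] by blast
    have "x = s"
    proof (rule ccontr)
      assume "x \<noteq> s"
      then have xs: "x \<in> {s<..t}" using x by (auto simp: S_def)
      have "\<forall>\<^sub>F h in at_right 0. h < x - s"
        using xs by (intro eventually_at_right_less order_tendstoD(2)[OF tendsto_ident_at]) auto
      with est[OF xs \<epsilon>] eventually_at_right_less[of "0::real"]
      have "\<forall>\<^sub>F h in at_right 0. 0 < h \<and> h < x - s \<and> f x - \<epsilon> * h \<le> f (x - h)"
        by eventually_elim simp
      then obtain h where h: "0 < h" "h < x - s" "f x - \<epsilon> * h \<le> f (x - h)"
        using eventually_happens'[OF trivial_limit_at_right_real] by blast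
      then have "x - h \<in> S"
        using x by (auto simp: S_def algebra_simps)
      then show False using min h(1) by fastforce
    qed
    then show ?thesis using x by (simp add: S_def)
  qed
  note * = this
  show ?thesis
  proof (rule field_le_epsilon)
    fix e :: real assume e: "e > 0"
    \<comment> \<open>Adding 1 to \<open>t - s\<close> keeps the denominator positive when
      \<open>s = t\<close>.\<close>
    have "f t \<le> f s + e / (t - s + 1) * (t - s)"
      using st e by (intro *) auto
    also have "e / (t - s + 1) * (t - s) \<le> e"
      using st e by (simp add: field_simps)
    finally show "f t \<le> f s + e" by simp
  qed
qed

text \<open>The integrating factor \<open>exp (l * (x - s))\<close> reduces exponential decay to
  monotonicity. Since \<open>1 - l * h \<le> exp (- l * h)\<close> and
  \<open>(1 - l * h) * (1 + h * l) = 1 - l^2 * h^2\<close>, the loss is only of second order in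
  \<open>h\<close>.\<close>

lemma exp_decay_from_left_estimate:
  fixes f :: "real \<Rightarrow> real"
  assumes st: "s \<le> t" and cont: "continuous_on {s..t} f" and l: "0 \<le> l"
    and nonneg: "\<And>x. 0 \<le> f x"
    and est: "\<And>x \<epsilon>. x \<in> {s<..t} \<Longrightarrow> \<epsilon> > 0
      \<Longrightarrow> \<forall>\<^sub>F h in at_right 0. (1 + h * l) * f x - \<epsilon> * h \<le> f (x - h)"
  shows "f t \<le> exp (- l * (t - s)) * f s"
proof -
  define F where "F x = exp (l * (x - s)) * f x" for x
  have "F t \<le> F s"
  proof (rule nonincreasing_from_left_estimate[OF st])
    show "continuous_on {s..t} F"
      unfolding F_def by (intro continuous_intros cont)
    fix x \<epsilon> :: real assume x: "x \<in> {s<..t}" and \<epsilon>: "\<epsilon> > 0"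
    define E where "E = exp (l * (x - s))"
    have E: "E > 0" by (simp add: E_def)
    have "((\<lambda>h. E * l^2 * f x * h) \<longlongrightarrow> E * l^2 * f x * 0) (at_right 0)"
      by (intro tendsto_intros)
    then have "\<forall>\<^sub>F h in at_right 0. E * l^2 * f x * h < \<epsilon> / 2"
      by (rule order_tendstoD) (use \<epsilon> in auto)
    \<comment> \<open>The error is divided by \<open>2 * E\<close> because the factor
      \<open>E\<close> multiplies it below. It then costs \<open>\<epsilon> / 2 * h\<close>, and the
      other half absorbs the term quadratic in \<open>h\<close>.\<close>
    moreover have "\<forall>\<^sub>F h in at_right 0. (1 + h * l) * f x - \<epsilon> / (2 * E) * h \<le> f (x - h)"
      by (intro est x) (use \<epsilon> E in auto)
    ultimately show "\<forall>\<^sub>F h in at_right 0. F x - \<epsilon> * h \<le> F (x - h)"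
      using eventually_at_right_less[of "0::real"]
    proof eventually_elim
      case (elim h)
      have "E * l^2 * f x * h * h \<le> \<epsilon> / 2 * h"
        using elim by (intro mult_right_mono) auto
      then have "E * f x - \<epsilon> * h \<le> E * ((1 - l * h) * (1 + h * l) * f x) - E * (\<epsilon> / (2 * E) * h)"
        using E by (simp add: algebra_simps power2_eq_square)
      also have "\<dots> \<le> E * (exp (- l * h) * (1 + h * l) * f x) - E * (exp (- l * h) * (\<epsilon> / (2 * E) * h))"
      proof -
        have "1 - l * h \<le> exp (- l * h)" using exp_ge_add_one_self[of "- l * h"] by simp
        then have "E * ((1 - l * h) * ((1 + h * l) * f x)) \<le> E * (exp (- l * h) * ((1 + h * l) * f x))"
          using E l elim nonneg by (intro mult_left_mono mult_right_mono) auto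
        moreover have "E * (exp (- l * h) * (\<epsilon> / (2 * E) * h)) \<le> E * (1 * (\<epsilon> / (2 * E) * h))"
          using E l elim \<epsilon> by (intro mult_left_mono mult_right_mono) auto
        ultimately show ?thesis by (simp add: mult.assoc)
      qed
      also have "\<dots> = E * exp (- l * h) * ((1 + h * l) * f x - \<epsilon> / (2 * E) * h)"
        by (simp add: algebra_simps)
      also have "\<dots> \<le> E * exp (- l * h) * f (x - h)"
        using elim E by (intro mult_left_mono) auto
      also have "E * exp (- l * h) = exp (l * (x - h - s))"
        by (simp add: E_def algebra_simps flip: exp_add)
      finally show ?case by (simp add: F_def E_def)
    qed
  qed
  then have "exp (l * (t - s)) * f t \<le> f s" by (simp add: F_def)
  then have "exp (- l * (t - s)) * (exp (l * (t - s)) * f t) \<le> exp (- l * (t - s)) * f s"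
    by (intro mult_left_mono) auto
  then show ?thesis by (simp flip: mult.assoc exp_add)
qed

text \<open>Gain and loss are compared through \<open>S\<close>, the tail weighted by
  \<open>a n t\<close>: the gain is at most \<open>\<kappa> * S\<close>, so the net loss is at least
  \<open>(1 - \<kappa>) * S\<close>. Only then is \<open>S\<close> bounded below by \<open>d\<close>
  times the tail.\<close>

lemma tailw_left_estimate:
  assumes nonneg: "\<forall>n\<ge>1. 0 \<le> a n t" "\<forall>n\<ge>1. \<forall>j\<ge>1. 0 \<le> b n j t"
    and upper: "\<forall>n\<ge>1. \<forall>j\<ge>1. j \<le> n \<longrightarrow> b n j t = 0"
    and w: "\<forall>n\<ge>1. 0 \<le> w n" and \<kappa>: "0 \<le> \<kappa>" "\<kappa> \<le> 1"
    and bound: "\<forall>j\<ge>2. (\<Sum>n = 1..<j. w n * b n j t) \<le> \<kappa> * w j"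
    and u: "\<And>s. 0 \<le> s \<Longrightarrow> u s \<in> ell1w w" and dom: "u t \<in> domG w a t"
    and deriv: "has_derivative_w w u (opG a b t (u t)) t"
    and t: "t > 0" and d: "\<And>n. n \<ge> 2 \<Longrightarrow> d \<le> a n t" and \<epsilon>: "\<epsilon> > 0"
  shows "\<forall>\<^sub>F h in at_right 0. (1 + h * (d * (1 - \<kappa>))) * tailw w (u t) - \<epsilon> * h \<le> tailw w (u (t - h))"
proof -
  define r where "r h = (\<lambda>n. (u (t + h) n - u t n) / of_real h - opG a b t (u t) n)" for h
  define S where "S = (\<Sum>\<^sub>\<infinity>n\<in>{2..}. w n * (a n t * cmod (u t n)))"
  have v: "opG a b t (u t) \<in> ell1w w" and lim: "((\<lambda>h. normw w (r h)) \<longlongrightarrow> 0) (at 0)"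
    using deriv by (auto simp: has_derivative_w_def r_def)
  have "\<forall>\<^sub>F h in at 0. normw w (r h) < \<epsilon>"
    using order_tendstoD(2)[OF lim \<epsilon>] .
  then obtain \<delta> where \<delta>: "\<delta> > 0" "\<And>h. h \<noteq> 0 \<Longrightarrow> \<bar>h\<bar> < \<delta> \<Longrightarrow> normw w (r h) < \<epsilon>"
    by (auto simp: eventually_at dist_real_def)
  have sS: "((\<lambda>n. w n * (a n t * cmod (u t n))) has_sum S) {2..}"
    unfolding S_def
    by (intro has_sum_infsum, rule summable_on_subset_banach[OF domG_summable[OF nonneg(1) dom]]) auto
  have sU: "((\<lambda>n. w n * cmod (u s n)) has_sum tailw w (u s)) {2..}" if "0 \<le> s" for s
    unfolding tailw_def by (intro has_sum_infsum ell1w_summable_tail u that)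
  have sB: "((\<lambda>n. w n * cmod (opB a b t (u t) n)) has_sum tailw w (opB a b t (u t))) {2..}"
    unfolding tailw_def by (intro has_sum_infsum tailw_opB_le(1)[where a=a and b=b and t=t and w=w and f="u t", OF nonneg upper w \<kappa>(1) bound dom])
  have dS: "d * tailw w (u t) \<le> S"
  proof (rule has_sum_mono[OF has_sum_cmult_right[OF sU] sS])
    fix n :: nat assume n: "n \<in> {2..}"
    have "w n * cmod (u t n) * d \<le> w n * cmod (u t n) * a n t"
      using d w n by (intro mult_left_mono) auto
    then show "d * (w n * cmod (u t n)) \<le> w n * (a n t * cmod (u t n))"
      by (simp add: mult_ac)
  qed (use t in auto)
  have "(1 + h * (d * (1 - \<kappa>))) * tailw w (u t) - \<epsilon> * h \<le> tailw w (u (t - h))"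
    if h: "h > 0" "h < \<delta>" "h < t" for h
  proof -
    have r: "r (- h) \<in> ell1w w"
    proof -
      have "(\<lambda>n. u (t - h) n - u t n) \<in> ell1w w"
        using h by (intro ell1w_diff w u) auto
      from ell1w_lincomb[OF w this v, of "- 1 / of_real h" "- 1"]
      show ?thesis by (simp add: r_def)
    qed
    have sR: "((\<lambda>n. w n * cmod (r (- h) n)) has_sum tailw w (r (- h))) {2..}"
      unfolding tailw_def by (intro has_sum_infsum ell1w_summable_tail r)
    have "tailw w (r (- h)) \<le> \<epsilon>"
      using tailw_le_normw[OF w r] \<delta>(2)[of "- h"] h by simp
    then have R: "h * tailw w (r (- h)) \<le> h * \<epsilon>"
      using h by (intro mult_left_mono) auto
    have "h * tailw w (opB a b t (u t)) \<le> h * (\<kappa> * S)"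
      using tailw_opB_le(2)[where a=a and b=b and t=t and w=w and f="u t", OF nonneg upper w \<kappa>(1) bound dom] h
      unfolding S_def by (intro mult_left_mono) auto
    moreover have "tailw w (u t) + h * S
        \<le> tailw w (u (t - h)) + h * tailw w (opB a b t (u t)) + h * tailw w (r (- h))"
    proof (rule has_sum_mono[OF has_sum_add[OF sU has_sum_cmult_right[OF sS]]
            has_sum_add[OF has_sum_add[OF sU has_sum_cmult_right[OF sB]] has_sum_cmult_right[OF sR]]])
      fix n :: nat assume n: "n \<in> {2..}"
      let ?y = "of_real (1 + h * a n t) * u t n"
      \<comment> \<open>The definition of the remainder \<open>r (- h)\<close> solved for
        \<open>u t n\<close>, with the contribution of \<open>opA\<close> moved to the left.\<close>
      have "?y = u (t - h) n + of_real h * opB a b t (u t) n + of_real h * r (- h) n"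
        using h n by (simp add: r_def opG_def opA_def field_simps)
      then have "cmod ?y \<le> cmod (u (t - h) n) + h * cmod (opB a b t (u t) n) + h * cmod (r (- h) n)"
        using h by (smt (verit) norm_triangle_ineq norm_mult norm_of_real)
      moreover have "cmod ?y = (1 + h * a n t) * cmod (u t n)"
        using h nonneg(1) n by (simp add: norm_mult del: of_real_add of_real_mult)
      ultimately have "w n * ((1 + h * a n t) * cmod (u t n))
          \<le> w n * (cmod (u (t - h) n) + h * cmod (opB a b t (u t) n) + h * cmod (r (- h) n))"
        using w n by (intro mult_left_mono) auto
      then show "w n * cmod (u t n) + h * (w n * (a n t * cmod (u t n)))
          \<le> w n * cmod (u (t - h) n) + h * (w n * cmod (opB a b t (u t) n)) + h * (w n * cmod (r (- h) n))"
        by (simp add: algebra_simps)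
    qed (use h t in auto)
    moreover have "h * ((1 - \<kappa>) * (d * tailw w (u t))) \<le> h * ((1 - \<kappa>) * S)"
      using dS h \<kappa> by (intro mult_left_mono) auto
    ultimately show ?thesis
      using R by (simp add: algebra_simps)
  qed
  then show ?thesis
    \<comment> \<open>\<open>\<delta>\<close> keeps the remainder below \<open>\<epsilon>\<close>,
      and \<open>t\<close> keeps \<open>t - h\<close> positive.\<close>
    unfolding eventually_at_right_field using \<delta>(1) t by (intro exI[of _ "min \<delta> t"]) auto
qed

section \<open>Regularity of the mass and of the tail along a curve\<close>

lemma M1_has_derivative:
  assumes w: "\<forall>n\<ge>1. 0 \<le> w n" and A3: "A3 w"
    and u: "\<And>s. 0 \<le> s \<Longrightarrow> u s \<in> ell1w w"
    and deriv: "has_derivative_w w u v t" and t: "t > 0"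
  shows "((\<lambda>s. M1 (u s)) has_vector_derivative M1 v) (at t)"
proof -
  define r where "r h = (\<lambda>n. (u (t + h) n - u t n) / of_real h - v n)" for h
  have v: "v \<in> ell1w w" and lim: "((\<lambda>h. normw w (r h)) \<longlongrightarrow> 0) (at 0)"
    using deriv by (auto simp: has_derivative_w_def r_def)
  \<comment> \<open>\<open>M1\<close> is linear and bounded by \<open>normw w\<close>, so the scalar
    remainder is at most the norm of the remainder \<open>r h\<close>.\<close>
  have "((\<lambda>h. norm (M1 (u (t + h)) - M1 (u t) - h *\<^sub>R M1 v) / norm h) \<longlongrightarrow> 0) (at 0)"
  proof (rule tendsto_sandwich[OF _ _ tendsto_const lim])
    have "\<forall>\<^sub>F h in at 0. h \<noteq> 0 \<and> \<bar>h\<bar> < t"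
      using t by (auto simp: eventually_at dist_real_def)
    then show "\<forall>\<^sub>F h in at 0. norm (M1 (u (t + h)) - M1 (u t) - h *\<^sub>R M1 v) / norm h \<le> normw w (r h)"
    proof eventually_elim
      case (elim h)
      have th: "u (t + h) \<in> ell1w w" "u t \<in> ell1w w"
        using elim t by (auto intro!: u)
      have "r h \<in> ell1w w"
        using ell1w_lincomb[OF w ell1w_diff[OF w th] v, of "1 / of_real h" "- 1"] by (simp add: r_def)
      moreover have "M1 (r h) = (M1 (u (t + h)) - M1 (u t)) / of_real h - M1 v"
        using M1_lincomb[OF A3 ell1w_diff[OF w th] v, of "1 / of_real h" "- 1"]
          M1_lincomb[OF A3 th, of 1 "- 1"] by (simp add: r_def)
      ultimately have "cmod ((M1 (u (t + h)) - M1 (u t)) / of_real h - M1 v) \<le> normw w (r h)"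
        using norm_M1_le[OF A3] by metis
      moreover have "(M1 (u (t + h)) - M1 (u t)) / of_real h - M1 v
          = (M1 (u (t + h)) - M1 (u t) - h *\<^sub>R M1 v) / of_real h"
        using elim by (simp add: scaleR_conv_of_real field_simps)
      ultimately show ?case by (simp add: norm_divide)
    qed
  qed auto
  then show ?thesis
    by (simp add: has_vector_derivative_def has_derivative_at bounded_linear_scaleR_left)
qed

lemma continuous_on_w_M1:
  assumes w: "\<forall>n\<ge>1. 0 \<le> w n" and A3: "A3 w" and u: "continuous_on_w w S u"
  shows "continuous_on S (\<lambda>t. M1 (u t))"
  unfolding continuous_on_def
proof
  fix t assume t: "t \<in> S"
  have ut: "u s \<in> ell1w w" if "s \<in> S" for s using u that by (simp add: continuous_on_w_def)
  have "((\<lambda>s. M1 (u s) - M1 (u t)) \<longlongrightarrow> 0) (at t within S)"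
  proof (rule Lim_null_comparison)
    show "((\<lambda>s. normw w (\<lambda>n. u s n - u t n)) \<longlongrightarrow> 0) (at t within S)"
      using u t by (simp add: continuous_on_w_def)
    show "\<forall>\<^sub>F s in at t within S. norm (M1 (u s) - M1 (u t)) \<le> normw w (\<lambda>n. u s n - u t n)"
      unfolding eventually_at_filter
    proof (intro always_eventually allI impI)
      fix s assume "s \<in> S"
      then show "norm (M1 (u s) - M1 (u t)) \<le> normw w (\<lambda>n. u s n - u t n)"
        using norm_M1_le[OF A3 ell1w_diff[OF w ut[of s] ut[OF t]]]
          M1_lincomb[OF A3 ut[of s] ut[OF t], of 1 "- 1"] by simp
    qed
  qed
  then show "((\<lambda>s. M1 (u s)) \<longlongrightarrow> M1 (u t)) (at t within S)"
    by (rule LIM_zero_cancel)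
qed

text \<open>The tail is not linear; the reverse triangle inequality makes it Lipschitz with constant
  1 for \<open>normw w\<close>.\<close>

lemma continuous_on_w_tailw:
  assumes w: "\<forall>n\<ge>1. 0 \<le> w n" and u: "continuous_on_w w S u"
  shows "continuous_on S (\<lambda>t. tailw w (u t))"
  unfolding continuous_on_def
proof
  fix t assume t: "t \<in> S"
  have ut: "u s \<in> ell1w w" if "s \<in> S" for s using u that by (simp add: continuous_on_w_def)
  have "((\<lambda>s. tailw w (u s) - tailw w (u t)) \<longlongrightarrow> 0) (at t within S)"
  proof (rule Lim_null_comparison)
    show "((\<lambda>s. normw w (\<lambda>n. u s n - u t n)) \<longlongrightarrow> 0) (at t within S)"
      using u t by (simp add: continuous_on_w_def)
    show "\<forall>\<^sub>F s in at t within S. norm (tailw w (u s) - tailw w (u t)) \<le> normw w (\<lambda>n. u s n - u t n)"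
      unfolding eventually_at_filter
    proof (intro always_eventually allI impI)
      fix s assume "s \<in> S"
      then show "norm (tailw w (u s) - tailw w (u t)) \<le> normw w (\<lambda>n. u s n - u t n)"
        using tailw_triangle[OF w ut[of s] ut[OF t]]
          tailw_le_normw[OF w ell1w_diff[OF w ut[of s] ut[OF t]]] by simp
    qed
  qed
  then show "((\<lambda>s. tailw w (u s)) \<longlongrightarrow> tailw w (u t)) (at t within S)"
    by (rule LIM_zero_cancel)
qed

subsection \<open>Decay of solutions\<close>

locale fragmentation_solution =
  fixes w :: "nat \<Rightarrow> real" and \<kappa> :: real
    and a :: "nat \<Rightarrow> real \<Rightarrow> real" and b :: "nat \<Rightarrow> nat \<Rightarrow> real \<Rightarrow> real"
    and u\<^sub>0 :: "nat \<Rightarrow> complex" and u :: "real \<Rightarrow> nat \<Rightarrow> complex"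
  assumes kappa: "0 < \<kappa>" "\<kappa> < 1"
    and frag: "\<And>T. T > 0 \<Longrightarrow> frag_assms w \<kappa> a b T"
    and a1: "\<And>t. t \<ge> 0 \<Longrightarrow> a 1 t = 0"
    and mass: "\<And>j t. j \<ge> 2 \<Longrightarrow> t \<ge> 0 \<Longrightarrow> (\<Sum>n = 1..<j. real n * b n j t) = real j"
    and sol: "classical_solution w a b u\<^sub>0 u"
begin

lemma coeffs:
  assumes "t \<ge> 0"
  shows "\<forall>n\<ge>1. 0 \<le> a n t" "\<forall>n\<ge>1. \<forall>j\<ge>1. 0 \<le> b n j t"
    "\<forall>n\<ge>1. \<forall>j\<ge>1. j \<le> n \<longrightarrow> b n j t = 0"
    "\<forall>j\<ge>2. (\<Sum>n = 1..<j. w n * b n j t) \<le> \<kappa> * w j"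
proof -
  \<comment> \<open>The horizon must be positive, so \<open>t + 1\<close> also covers
    \<open>t = 0\<close>.\<close>
  have *: "frag_assms w \<kappa> a b (t + 1)" "t \<in> {0..t+1}" using frag[of "t + 1"] assms by auto
  from *(1) have **: "A1 a (t+1)" "A2 b (t+1)" "A4 w \<kappa> b (t+1)" by (auto simp: frag_assms_def)
  show "\<forall>n\<ge>1. 0 \<le> a n t" using **(1) *(2) unfolding A1_def by blast
  show "\<forall>n\<ge>1. \<forall>j\<ge>1. 0 \<le> b n j t" using **(2) *(2) unfolding A2_def by blast
  show "\<forall>n\<ge>1. \<forall>j\<ge>1. j \<le> n \<longrightarrow> b n j t = 0" using **(2) *(2) unfolding A2_def by blast
  show "\<forall>j\<ge>2. (\<Sum>n = 1..<j. w n * b n j t) \<le> \<kappa> * w j" using **(3) *(2) unfolding A4_def by blast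
qed

lemma weight: "A3 w"
  using frag[of 1] by (simp add: frag_assms_def)

lemma weight_nonneg: "\<forall>n\<ge>1. 0 \<le> w n"
  using weight unfolding A3_def by (meson of_nat_0_le_iff order_trans)

lemma solution:
  shows "continuous_on_w w {0..} u" "u 0 = u\<^sub>0"
    and "\<And>t. t \<ge> 0 \<Longrightarrow> u t \<in> ell1w w"
    and "\<And>t. t > 0 \<Longrightarrow> has_derivative_w w u (opG a b t (u t)) t"
    and "\<And>t. t > 0 \<Longrightarrow> u t \<in> domG w a t"
  using sol by (auto simp: classical_solution_def continuous_on_w_def)

lemma M1_conserved:
  assumes "t \<ge> 0"
  shows "M1 (u t) = M1 u\<^sub>0"
\<comment> \<open>The equation holds only for positive times; the exceptional point 0 is bridged by
  continuity.\<close>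
proof (rule has_derivative_zero_unique_strong_convex[where f="\<lambda>t. M1 (u t)" and S="{0..}" and K="{0}" and c=0])
  show "continuous_on {0..} (\<lambda>t. M1 (u t))"
    by (rule continuous_on_w_M1[OF weight_nonneg weight solution(1)])
  fix s :: real assume "s \<in> {0..} - {0}"
  then have s: "s > 0" by auto
  then have "M1 (opG a b s (u s)) = 0"
    using coeffs[of s] mass a1 weight solution(5) by (intro M1_opG) auto
  then have "((\<lambda>t. M1 (u t)) has_vector_derivative 0) (at s)"
    using M1_has_derivative[OF weight_nonneg weight solution(3) solution(4)[OF s] s] by simp
  then show "((\<lambda>t. M1 (u t)) has_derivative (\<lambda>h. 0)) (at s within {0..})"
    by (simp add: has_vector_derivative_def has_derivative_at_withinI)
qed (use assms solution(2) in auto)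

text \<open>The start \<open>s\<close> is free so that a lower bound on the rates valid only at late
  times suffices. Taking \<open>d = 0\<close> shows that the tail never grows.\<close>

lemma tailw_decay:
  assumes st: "0 \<le> s" "s \<le> t" and d: "0 \<le> d" "\<And>x n. s < x \<Longrightarrow> 2 \<le> n \<Longrightarrow> d \<le> a n x"
  shows "tailw w (u t) \<le> exp (- (d * (1 - \<kappa>)) * (t - s)) * tailw w (u s)"
proof (rule exp_decay_from_left_estimate[where f="\<lambda>t. tailw w (u t)", OF st(2)])
  show "continuous_on {s..t} (\<lambda>t. tailw w (u t))"
    by (rule continuous_on_subset[OF continuous_on_w_tailw[OF weight_nonneg solution(1)]])
       (use st in auto)
  show "0 \<le> d * (1 - \<kappa>)" using d(1) kappa by simp
  fix x \<epsilon> :: real assume x: "x \<in> {s<..t}" and \<epsilon>: "\<epsilon> > 0"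
  then have x0: "x > 0" using st by auto
  show "\<forall>\<^sub>F h in at_right 0. (1 + h * (d * (1 - \<kappa>))) * tailw w (u x) - \<epsilon> * h \<le> tailw w (u (x - h))"
    using x x0 kappa \<epsilon> d(2)
    by (intro tailw_left_estimate[where a=a and b=b and w=w, OF coeffs(1-3) weight_nonneg _ _ coeffs(4) solution(3) solution(5) solution(4)]) auto
qed (rule tailw_nonneg[OF weight_nonneg])

lemma equilibrium_distance_le:
  assumes "t \<ge> 0"
  shows "normw w (\<lambda>n. u t n - M1 u\<^sub>0 * e1 n) \<le> (w 1 + 1) * tailw w (u t)"
  using normw_minus_equilibrium_le[OF weight_nonneg weight solution(3)[OF assms]]
  by (simp add: M1_conserved[OF assms])

text \<open>The infimum is taken in the reals, so a lower bound must be supplied; nonnegativity of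
  the coefficients provides 0.\<close>

lemma INF_le_coeff:
  assumes "t \<ge> 0" "n \<ge> 2"
  shows "(INF n\<in>{2..}. a n t) \<le> a n t"
  using coeffs(1)[OF assms(1)] assms(2) by (intro cINF_lower bdd_belowI2[of _ 0]) auto

lemma INF_nonneg:
  assumes "t \<ge> 0"
  shows "0 \<le> (INF n\<in>{2..}. a n t)"
  using coeffs(1)[OF assms(1)] by (intro cINF_greatest) auto

lemma uniform_decay:
  fixes d :: real
  defines "d \<equiv> INF t\<in>{0<..}. INF n\<in>{2..}. a n t"
  assumes d: "d > 0" and t: "t \<ge> 0"
  shows "normw w (\<lambda>n. u t n - M1 u\<^sub>0 * e1 n) \<le> (w 1 + 1) * normw w u\<^sub>0 * exp (- d * (1 - \<kappa>) * t)"
proof -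
  have "d \<le> a n x" if "0 < x" "2 \<le> n" for x n
  proof -
    have "d \<le> (INF n\<in>{2..}. a n x)"
      unfolding d_def using that INF_nonneg by (intro cINF_lower bdd_belowI2[of _ 0]) auto
    then show ?thesis using INF_le_coeff[of x n] that by simp
  qed
  then have "tailw w (u t) \<le> exp (- d * (1 - \<kappa>) * t) * tailw w (u 0)"
    using tailw_decay[of 0 t d] t d by simp
  also have "\<dots> \<le> exp (- d * (1 - \<kappa>) * t) * normw w u\<^sub>0"
    using tailw_le_normw[OF weight_nonneg solution(3)[of 0]] by (simp add: solution(2))
  finally have "(w 1 + 1) * tailw w (u t) \<le> (w 1 + 1) * (exp (- d * (1 - \<kappa>) * t) * normw w u\<^sub>0)"
    using weight_nonneg by (intro mult_left_mono) auto
  then show ?thesis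
    using equilibrium_distance_le[OF t] by (simp add: mult_ac)
qed

text \<open>A rate \<open>d\<close> strictly between \<open>c / (1 - \<kappa>)\<close> and the limit
  inferior bounds all \<open>a n t\<close> with \<open>n \<ge> 2\<close> from below after some time
  \<open>s\<close>. Before \<open>s\<close> the tail does not grow, and a constant factor makes up
  for the missing decay.\<close>

lemma asymptotic_decay:
  assumes pos: "0 < Liminf at_top (\<lambda>t::real. ereal (INF n\<in>{2..}. a n t))"
    and c: "ereal c < Liminf at_top (\<lambda>t::real. ereal (INF n\<in>{2..}. a n t)) * ereal (1 - \<kappa>)"
  shows "\<exists>M>0. \<forall>t\<ge>0. normw w (\<lambda>n. u t n - M1 u\<^sub>0 * e1 n) \<le> M * exp (- c * t)"
proof -
  let ?L = "Liminf at_top (\<lambda>t::real. ereal (INF n\<in>{2..}. a n t))"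
  \<comment> \<open>\<open>?L\<close> may be infinite, so the division is carried out by
    cases.\<close>
  have "ereal (c / (1 - \<kappa>)) < ?L"
    using c kappa by (cases ?L) (auto simp: field_simps)
  \<comment> \<open>The maximum with 0 makes \<open>d\<close> nonnegative, as
    \<open>tailw_decay\<close> demands, even when \<open>c\<close> is negative.\<close>
  then have "ereal (max 0 (c / (1 - \<kappa>))) < ?L"
    using pos by (auto simp: max_def zero_ereal_def)
  then obtain d where d: "max 0 (c / (1 - \<kappa>)) < d" "ereal d < ?L"
    using ereal_dense2 by (metis less_ereal.simps(1))
  have "\<forall>\<^sub>F t in at_top. ereal d < ereal (INF n\<in>{2..}. a n t)"
    by (rule less_LiminfD[OF d(2)])
  then obtain N where N: "\<And>t. t \<ge> N \<Longrightarrow> d < (INF n\<in>{2..}. a n t)"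
    by (auto simp: eventually_at_top_linorder)
  define s where "s = max 0 N"
  have s0: "s \<ge> 0" by (simp add: s_def)
  have ad: "d \<le> a n x" if "s < x" "2 \<le> n" for x n
    using N[of x] INF_le_coeff[of x n] that by (auto simp: s_def)
  have c_le: "c \<le> d * (1 - \<kappa>)" and "0 \<le> d"
    using d(1) kappa by (auto simp: field_simps)
  have tail0: "tailw w (u t) \<le> tailw w (u 0)" if "t \<ge> 0" for t
    using tailw_decay[of 0 t 0] coeffs(1) that by auto
  \<comment> \<open>The exponential pays for the time before \<open>s\<close> for either sign of
    \<open>c\<close>. The added 1 keeps \<open>M\<close> positive when the initial tail
    vanishes.\<close>
  define M where "M = (w 1 + 1) * (tailw w (u 0) + 1) * exp (\<bar>c\<bar> * s)"
  have w1: "w 1 \<ge> 0" using weight_nonneg by auto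
  have t0: "tailw w (u 0) \<ge> 0" by (rule tailw_nonneg[OF weight_nonneg])
  have "normw w (\<lambda>n. u t n - M1 u\<^sub>0 * e1 n) \<le> M * exp (- c * t)" if t: "t \<ge> 0" for t
  proof -
    have "tailw w (u t) \<le> exp (\<bar>c\<bar> * s) * exp (- c * t) * tailw w (u 0)"
    proof (cases "t \<le> s")
      case True
      have "c * t \<le> \<bar>c\<bar> * s"
        using True t by (intro mult_mono) auto
      then have "1 \<le> exp (\<bar>c\<bar> * s) * exp (- c * t)"
        by (simp flip: exp_add)
      then have "1 * tailw w (u 0) \<le> exp (\<bar>c\<bar> * s) * exp (- c * t) * tailw w (u 0)"
        using t0 by (rule mult_right_mono)
      then show ?thesis using tail0[OF t] by simp
    next
      case False
      have "tailw w (u t) \<le> exp (- (d * (1 - \<kappa>)) * (t - s)) * tailw w (u s)"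
        using False ad \<open>0 \<le> d\<close> by (intro tailw_decay) (auto simp: s_def)
      also have "\<dots> \<le> exp (- c * (t - s)) * tailw w (u 0)"
        using False c_le t0 tail0[of s] tailw_nonneg[OF weight_nonneg]
        by (intro mult_mono) (auto simp: s0 mult_right_mono)
      also have "\<dots> \<le> exp (\<bar>c\<bar> * s - c * t) * tailw w (u 0)"
      proof -
        have "c * s \<le> \<bar>c\<bar> * s" by (intro mult_right_mono) (auto simp: s_def)
        then show ?thesis using t0 by (intro mult_right_mono) (auto simp: algebra_simps)
      qed
      finally show ?thesis by (simp flip: exp_add)
    qed
    also have "\<dots> \<le> exp (\<bar>c\<bar> * s) * exp (- c * t) * (tailw w (u 0) + 1)"
      by (intro mult_left_mono) auto
    finally have "(w 1 + 1) * tailw w (u t)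
        \<le> (w 1 + 1) * (exp (\<bar>c\<bar> * s) * exp (- c * t) * (tailw w (u 0) + 1))"
      using w1 by (intro mult_left_mono) auto
    then show ?thesis
      using equilibrium_distance_le[OF t] by (simp add: M_def mult_ac)
  qed
  moreover have "M > 0"
    unfolding M_def using w1 t0 by (intro mult_pos_pos) auto
  ultimately show ?thesis by blast
qed

end

theorem theorem4p5:
  fixes w :: "nat \<Rightarrow> real"
    and \<kappa> :: real
    and a :: "nat \<Rightarrow> real \<Rightarrow> real"
    and b :: "nat \<Rightarrow> nat \<Rightarrow> real \<Rightarrow> real"
    and u\<^sub>0 :: "nat \<Rightarrow> complex"
    and u :: "real \<Rightarrow> nat \<Rightarrow> complex"
  assumes "\<forall>n\<ge>1. w n > 0"
    and "0 < \<kappa>" and "\<kappa> < 1"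
    and "\<forall>T>0. frag_assms w \<kappa> a b T"
    and "\<forall>t\<ge>0. a 1 t = 0"
    and "\<forall>j\<ge>2. \<forall>t\<ge>0. (\<Sum>n = 1..<j. real n * b n j t) = real j"
    and "u\<^sub>0 \<in> ell1w_pos w"
    and "classical_solution w a b u\<^sub>0 u"
  shows
    "((INF t\<in>{0<..}. INF n\<in>{2..}. a n t) > 0 \<longrightarrow>
       (\<forall>t\<ge>0. normw w (\<lambda>n. u t n - M1 u\<^sub>0 * e1 n)
          \<le> (w 1 + 1) * normw w u\<^sub>0
              * exp (- (INF t\<in>{0<..}. INF n\<in>{2..}. a n t) * (1 - \<kappa>) * t)))
     \<and>
     (Liminf at_top (\<lambda>t::real. ereal (INF n\<in>{2..}. a n t)) > 0 \<longrightarrow>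
       (\<forall>c::real.
          ereal c < Liminf at_top (\<lambda>t::real. ereal (INF n\<in>{2..}. a n t)) * ereal (1 - \<kappa>) \<longrightarrow>
          (\<exists>M>0. \<forall>t\<ge>0. normw w (\<lambda>n. u t n - M1 u\<^sub>0 * e1 n) \<le> M * exp (- c * t))))"
proof -
  interpret fragmentation_solution w \<kappa> a b u\<^sub>0 u
    using assms by unfold_locales auto
  show ?thesis
    using uniform_decay asymptotic_decay by blast
qed

end
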